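(* (Failure probability bound, log-normal diffusion.) Let $D$, $a$, $\beta_N$, $c_\beta$ and the log-normal random field $\nu$ with $\nu_{\min}$ be as in the context, and write $\|a\|_\infty=\|a\|_{L^\infty((0,\infty)\times D;\mathbb R)}$. Then for every $p\in[1,\infty)$, $$\mathbb P\left[\nu_{\min}(\omega)\,\beta_{\bar N}\le3\|a\|_\infty\right]=\mathcal O\left(\bar N^{-2p}\left(3c_\beta^{-1}\|a\|_\infty\right)^p\right),$$ that is, for every $p\in[1,\infty)$ there is a constant $C_p>0$, independent of $\bar N$ and $a$, such that for all integers $\bar N\ge1$ with $\beta_{\bar N}\ge3\|a\|_\infty$ the probability on the left is at most $C_p\bar N^{-2p}(3c_\beta^{-1}\|a\|_\infty)^p$.
   Context: $D=\prod_{n=1}^d(0,L_n)\subset\mathbb R^d$, $L_n>0$; $H=L^2(D;\mathbb R)$, $V=H_0^1(D;\mathbb R)$ with $\|v\|_V=\|\nabla v\|_{L^2(D)}$. $a\in L^\infty((0,\infty)\times D;\mathbb R)$ is deterministic. Fix $\varrho\in(0,1)$. For $N\ge1$ and $\mathbf i\in\{1,\dots,N\}^d$ let $O_{\mathbf i,N}=\prod_{n=1}^d\big(\frac{(2i_n-1)L_n}{2N}-\frac{\varrho L_n}{2N},\frac{(2i_n-1)L_n}{2N}+\frac{\varrho L_n}{2N}\big)$, let $\mathcal O_N$ be the span of the indicator functions $\mathbf 1_{O_{\mathbf i,N}}$, and $\beta_N=\inf\{\|Q\|_V^2/\|Q\|_H^2:Q\in V\cap\mathcal O_N^\perp,\ Q\ne0\}$,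 where $\perp$ is the orthogonal complement in $H$. The constant $c_\beta>0$ is independent of $N$ and satisfies $\beta_N\ge c_\beta N^2$ for all $N\ge 1$ (such a constant exists). Diffusion: $\nu(\omega,x)=\exp\big(\sum_{j=1}^\infty z_j(\omega)\psi_j(x)\big)$, where $\psi_j\in L^\infty(D;\mathbb R)$ with $\sum_{j\ge1}\|\psi_j\|_{L^\infty(D)}<\infty$ and the $z_j$ are i.i.d. standard normal random variables, realized as coordinates on $\Omega=\{z\in\mathbb R^{\mathbb N}:\sum_j|z_j|\|\psi_j\|_{L^\infty(D)}<\infty\}$ with $\mathbb P=\bigotimes_{j\ge1}\mathcal N(0,1)$ (so $\mathbb P(\Omega)=1$). Set $\nu_{\min}(\omega)=\exp\big(-\sum_{j\ge1}|z_j(\omega)|\|\psi_j\|_{L^\infty(D)}\big)$. "Failure" with $\bar N$ as actuator parameter means the event $\nu_{\min}(\omega)\beta_{\bar N}\le3\|a\|_\infty$, i.e. the condition $\nu_{\min}(\omega)\beta_{\bar N}>3\|a\|_\infty$ guaranteeing stabilizability of $\partial_ty-\nabla\cdot(\nu\nabla y)+ay=\sum_{\mathbf i}u_{\mathbf i}\mathbf 1_{O_{\mathbf i,\bar N}}$ by the receding horizon control does not hold. *)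

theory Defs
  imports "HOL-Probability.Probability"
begin

subsection \<open>Lebesgue spaces\<close>

text \<open>
  Elements of \<open>L\<^sup>2\<close> and \<open>L\<^sup>\<infinity>\<close> are represented by functions; equality in these spaces is equality
  almost everywhere.
\<close>

definition L2_space :: "'a measure \<Rightarrow> ('a \<Rightarrow> 'b::euclidean_space) set" where
  "L2_space M = {f \<in> borel_measurable M. integrable M (\<lambda>x. (norm (f x))\<^sup>2)}"

definition L2_norm :: "'a measure \<Rightarrow> ('a \<Rightarrow> 'b::euclidean_space) \<Rightarrow> real" where
  "L2_norm M f = sqrt (\<integral>x. (norm (f x))\<^sup>2 \<partial>M)"

definition Linf_space :: "'a measure \<Rightarrow> ('a \<Rightarrow> real) set" where
  "Linf_space M = {f \<in> borel_measurable M. esssup M (\<lambda>x. ereal \<bar>f x\<bar>) < \<infinity>}"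

definition Linf_norm :: "'a measure \<Rightarrow> ('a \<Rightarrow> real) \<Rightarrow> real" where
  "Linf_norm M f = real_of_ereal (esssup M (\<lambda>x. ereal \<bar>f x\<bar>))"


subsection \<open>The Sobolev space \<open>H\<^sub>0\<^sup>1\<close>\<close>

definition partial_deriv :: "'d \<Rightarrow> (real^'d \<Rightarrow> real) \<Rightarrow> real^'d::finite \<Rightarrow> real" where
  "partial_deriv i f x = deriv (\<lambda>t. f (x + t *\<^sub>R axis i 1)) 0"

definition gradient :: "(real^'d \<Rightarrow> real) \<Rightarrow> real^'d::finite \<Rightarrow> real^'d" where
  "gradient f x = (\<chi> i. partial_deriv i f x)"

text \<open>All iterated partial derivatives exist and are continuous.\<close>

definition smooth_fun :: "(real^'d::finite \<Rightarrow> real) \<Rightarrow> bool" where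
  "smooth_fun f \<longleftrightarrow> (\<forall>is. continuous_on UNIV (foldr partial_deriv is f) \<and>
     (\<forall>i x. (\<lambda>t. foldr partial_deriv is f (x + t *\<^sub>R axis i 1)) differentiable at 0))"

text \<open>\<open>C\<^sub>c\<^sup>\<infinity>(D)\<close>, with functions extended by zero outside the open set \<open>D\<close>.\<close>

definition test_functions :: "(real^'d::finite) set \<Rightarrow> (real^'d \<Rightarrow> real) set" where
  "test_functions D = {\<phi>. smooth_fun \<phi> \<and> (\<exists>K. compact K \<and> K \<subseteq> D \<and> (\<forall>x. x \<notin> K \<longrightarrow> \<phi> x = 0))}"

definition has_weak_gradient ::
  "(real^'d::finite) set \<Rightarrow> (real^'d \<Rightarrow> real) \<Rightarrow> (real^'d \<Rightarrow> real^'d) \<Rightarrow> bool" where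
  "has_weak_gradient D v g \<longleftrightarrow> v \<in> L2_space (lebesgue_on D) \<and> g \<in> L2_space (lebesgue_on D) \<and>
     (\<forall>\<phi>\<in>test_functions D. \<forall>i.
        (\<integral>x. v x * partial_deriv i \<phi> x \<partial>lebesgue_on D) = - (\<integral>x. g x $ i * \<phi> x \<partial>lebesgue_on D))"

text \<open>The weak gradient is unique up to a null set, so the choice is immaterial under integrals.\<close>

definition weak_gradient ::
  "(real^'d::finite) set \<Rightarrow> (real^'d \<Rightarrow> real) \<Rightarrow> real^'d \<Rightarrow> real^'d" where
  "weak_gradient D v = (SOME g. has_weak_gradient D v g)"

text \<open>\<open>H\<^sub>0\<^sup>1(D)\<close> is the closure of \<open>C\<^sub>c\<^sup>\<infinity>(D)\<close> in \<open>H\<^sup>1(D)\<close>.\<close>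

definition H01 :: "(real^'d::finite) set \<Rightarrow> (real^'d \<Rightarrow> real) set" where
  "H01 D = {v. (\<exists>g. has_weak_gradient D v g) \<and>
     (\<exists>\<phi>::nat \<Rightarrow> real^'d \<Rightarrow> real. (\<forall>k. \<phi> k \<in> test_functions D) \<and>
        (\<lambda>k. L2_norm (lebesgue_on D) (\<lambda>x. \<phi> k x - v x)) \<longlonglongrightarrow> 0 \<and>
        (\<lambda>k. L2_norm (lebesgue_on D) (\<lambda>x. gradient (\<phi> k) x - weak_gradient D v x)) \<longlonglongrightarrow> 0)}"

definition H01_norm :: "(real^'d::finite) set \<Rightarrow> (real^'d \<Rightarrow> real) \<Rightarrow> real" where
  "H01_norm D v = L2_norm (lebesgue_on D) (weak_gradient D v)"


subsection \<open>Actuators and the constants \<open>\<beta>\<^sub>N\<close>\<close>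

definition domain_box :: "real^'d::finite \<Rightarrow> (real^'d) set" where
  "domain_box L = box 0 L"

definition actuator_indices :: "nat \<Rightarrow> (nat^'d::finite) set" where
  "actuator_indices N = {i. \<forall>n. i $ n \<in> {1..N}}"

definition actuator_box :: "real^'d::finite \<Rightarrow> real \<Rightarrow> nat \<Rightarrow> nat^'d \<Rightarrow> (real^'d) set" where
  "actuator_box L \<rho> N i =
     box (\<chi> n. (2 * real (i $ n) - 1) * L $ n / (2 * real N) - \<rho> * L $ n / (2 * real N))
         (\<chi> n. (2 * real (i $ n) - 1) * L $ n / (2 * real N) + \<rho> * L $ n / (2 * real N))"

definition actuator_span :: "real^'d::finite \<Rightarrow> real \<Rightarrow> nat \<Rightarrow> (real^'d \<Rightarrow> real) set" where
  "actuator_span L \<rho> N =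
     {\<lambda>x. \<Sum>i\<in>actuator_indices N. c i * indicator (actuator_box L \<rho> N i) x | c. True}"

definition actuator_perp :: "real^'d::finite \<Rightarrow> real \<Rightarrow> nat \<Rightarrow> (real^'d \<Rightarrow> real) set" where
  "actuator_perp L \<rho> N = {Q \<in> L2_space (lebesgue_on (domain_box L)).
     \<forall>w\<in>actuator_span L \<rho> N. (\<integral>x. Q x * w x \<partial>lebesgue_on (domain_box L)) = 0}"

definition beta :: "real^'d::finite \<Rightarrow> real \<Rightarrow> nat \<Rightarrow> real" where
  "beta L \<rho> N = Inf {(H01_norm (domain_box L) Q)\<^sup>2 / (L2_norm (lebesgue_on (domain_box L)) Q)\<^sup>2 | Q.
     Q \<in> H01 (domain_box L) \<inter> actuator_perp L \<rho> N \<and>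
     \<not> (AE x in lebesgue_on (domain_box L). Q x = 0)}"


subsection \<open>The log-normal diffusion\<close>

text \<open>The random field is indexed by \<open>j = 0, 1, \<dots>\<close> instead of \<open>j = 1, 2, \<dots>\<close>.\<close>

definition sample_space ::
  "(real^'d::finite) set \<Rightarrow> (nat \<Rightarrow> real^'d \<Rightarrow> real) \<Rightarrow> (nat \<Rightarrow> real) set" where
  "sample_space D \<psi> = {z. summable (\<lambda>j. \<bar>z j\<bar> * Linf_norm (lebesgue_on D) (\<psi> j))}"

definition sample_measure ::
  "(real^'d::finite) set \<Rightarrow> (nat \<Rightarrow> real^'d \<Rightarrow> real) \<Rightarrow> (nat \<Rightarrow> real) measure" where
  "sample_measure D \<psi> =
     restrict_space (\<Pi>\<^sub>M j\<in>(UNIV::nat set). std_normal_distribution) (sample_space D \<psi>)"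

definition diffusion ::
  "(nat \<Rightarrow> real^'d::finite \<Rightarrow> real) \<Rightarrow> (nat \<Rightarrow> real) \<Rightarrow> real^'d \<Rightarrow> real" where
  "diffusion \<psi> z x = exp (\<Sum>j. z j * \<psi> j x)"

definition diffusion_min ::
  "(real^'d::finite) set \<Rightarrow> (nat \<Rightarrow> real^'d \<Rightarrow> real) \<Rightarrow> (nat \<Rightarrow> real) \<Rightarrow> real" where
  "diffusion_min D \<psi> z = exp (- (\<Sum>j. \<bar>z j\<bar> * Linf_norm (lebesgue_on D) (\<psi> j)))"

lemma AE_abs_le_Linf_norm:
  assumes "f \<in> Linf_space M"
  shows "AE x in M. \<bar>f x\<bar> \<le> Linf_norm M f"
proof -
  have "AE x in M. ereal \<bar>f x\<bar> \<le> esssup M (\<lambda>x. ereal \<bar>f x\<bar>)"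
    by (rule esssup_AE)
  then show ?thesis
  proof (eventually_elim)
    case (elim x)
    then show ?case using assms
      by (cases "esssup M (\<lambda>x. ereal \<bar>f x\<bar>)") (auto simp: Linf_norm_def Linf_space_def)
  qed
qed

lemma diffusion_min_le_diffusion:
  assumes "\<And>j. \<psi> j \<in> Linf_space (lebesgue_on D)" and "z \<in> sample_space D \<psi>"
  shows "AE x in lebesgue_on D. diffusion_min D \<psi> z \<le> diffusion \<psi> z x"
proof -
  have "AE x in lebesgue_on D. \<forall>j. \<bar>\<psi> j x\<bar> \<le> Linf_norm (lebesgue_on D) (\<psi> j)"
    unfolding AE_all_countable using AE_abs_le_Linf_norm[OF assms(1)] by blast
  then show ?thesis
  proof (eventually_elim)
    case (elim x)
    have s: "summable (\<lambda>j. \<bar>z j\<bar> * Linf_norm (lebesgue_on D) (\<psi> j))"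
      using assms(2) by (simp add: sample_space_def)
    have le: "norm (z j * \<psi> j x) \<le> \<bar>z j\<bar> * Linf_norm (lebesgue_on D) (\<psi> j)" for j
      using elim by (simp add: abs_mult mult_left_mono)
    have "summable (\<lambda>j. norm (z j * \<psi> j x))"
      by (rule summable_comparison_test'[OF s, of 0]) (use le in simp)
    then have "\<bar>\<Sum>j. z j * \<psi> j x\<bar> \<le> (\<Sum>j. \<bar>z j * \<psi> j x\<bar>)"
      by (intro summable_rabs) simp
    also have "\<dots> \<le> (\<Sum>j. \<bar>z j\<bar> * Linf_norm (lebesgue_on D) (\<psi> j))"
      using \<open>summable (\<lambda>j. norm (z j * \<psi> j x))\<close> s le by (intro suminf_le) auto
    finally show ?case
      by (simp add: diffusion_def diffusion_min_def)
  qed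
qed

end

theory Submission
  imports Defs
begin

text \<open>
  Write \<open>S(z) = \<Sum>\<^sub>j \<bar>z\<^sub>j\<bar> \<ell>\<^sub>j\<close> with \<open>\<ell>\<^sub>j = \<parallel>\<psi>\<^sub>j\<parallel>\<^sub>\<infinity>\<close>, so that \<open>\<nu>\<^sub>m\<^sub>i\<^sub>n = exp (- S)\<close>. With
  \<open>A = 3 \<parallel>a\<parallel>\<^sub>\<infinity> > 0\<close>, failure means \<open>exp (p S) \<ge> (\<beta>\<^sub>N / A) powr p\<close>, so Markov's inequality
  bounds its probability by \<open>(A / \<beta>\<^sub>N) powr p\<close> times the exponential moment of \<open>p S\<close>, and
  \<open>\<beta>\<^sub>N \<ge> c\<^sub>\<beta> N\<^sup>2\<close> turns this into the claimed rate. If \<open>A \<le> 0\<close>, failure is impossible, because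
  \<open>\<nu>\<^sub>m\<^sub>i\<^sub>n\<close> and \<open>\<beta>\<^sub>N\<close> are positive.

  The point is therefore that \<open>exp (p S)\<close> has finite expectation, which is
  \<open>nn_integral_exp_series_finite\<close>. The expectation factorizes over the independent coordinates,
  but estimating the infinite product can be avoided: with \<open>\<Lambda> = 1 + \<Sum>\<^sub>j \<ell>\<^sub>j\<close>, Jensen's inequality
  (\<open>exp_weighted_series_le\<close>) for the weights \<open>\<ell>\<^sub>j / \<Lambda>\<close> bounds \<open>exp (p S)\<close> by
  \<open>1 + \<Sum>\<^sub>j (\<ell>\<^sub>j / \<Lambda>) exp (p \<Lambda> \<bar>z\<^sub>j\<bar>)\<close>. Integrating this term by term uses the distribution of each
  single coordinate only, and the normal distribution has all exponential moments
  (\<open>std_normal_exp_abs_finite\<close>).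
\<close>

section \<open>Exponential moments\<close>

text \<open>Completing the square turns the density tilted by \<open>exp (t x)\<close> into a shifted normal density.\<close>

lemma std_normal_density_tilt:
  "std_normal_density x * exp (t * x) = exp (t\<^sup>2 / 2) * normal_density t 1 x"
proof -
  have "- x\<^sup>2 / 2 + t * x = t\<^sup>2 / 2 + - (x - t)\<^sup>2 / 2"
    by (simp add: power2_eq_square algebra_simps diff_divide_distrib add_divide_distrib)
  then have "exp (- x\<^sup>2 / 2) * exp (t * x) = exp (t\<^sup>2 / 2) * exp (- (x - t)\<^sup>2 / 2)"
    by (simp only: exp_add[symmetric])
  then show ?thesis
    by (simp add: normal_density_def)
qed

lemma std_normal_exp_abs_finite:
  "(\<integral>\<^sup>+ x. ennreal (exp (t * \<bar>x\<bar>)) \<partial>std_normal_distribution) < \<infinity>"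
proof -
  have "(\<integral>\<^sup>+ x. ennreal (exp (t * \<bar>x\<bar>)) \<partial>std_normal_distribution)
    = (\<integral>\<^sup>+ x. ennreal (std_normal_density x * exp (t * \<bar>x\<bar>)) \<partial>lborel)"
    by (subst nn_integral_density) (auto simp: ennreal_mult')
  also have "\<dots> \<le> (\<integral>\<^sup>+ x. ennreal (exp (t\<^sup>2 / 2) * (normal_density t 1 x + normal_density (- t) 1 x)) \<partial>lborel)"
  proof (rule nn_integral_mono, rule ennreal_leI)
    fix x :: real
    have "std_normal_density x * exp (t * \<bar>x\<bar>)
      \<le> std_normal_density x * exp (t * x) + std_normal_density x * exp ((- t) * x)"
      by (cases "0 \<le> x") simp_all
    then show "std_normal_density x * exp (t * \<bar>x\<bar>)
      \<le> exp (t\<^sup>2 / 2) * (normal_density t 1 x + normal_density (- t) 1 x)"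
      unfolding std_normal_density_tilt by (simp add: distrib_left)
  qed
  also have "\<dots> < \<infinity>"
    by (subst nn_integral_eq_integral) (auto intro!: mult_nonneg_nonneg add_nonneg_nonneg)
  finally show ?thesis .
qed

text \<open>
  Jensen's inequality for a countable sub-probability, the missing mass being placed at \<open>0\<close>: sum
  the tangent line inequality at the barycentre \<open>m = \<Sum>\<^sub>j w\<^sub>j x\<^sub>j\<close> over all the mass.
\<close>

lemma exp_weighted_series_le:
  fixes w x :: "nat \<Rightarrow> real"
  assumes w: "\<And>j. 0 \<le> w j" "summable w" "suminf w \<le> 1"
    and x: "summable (\<lambda>j. w j * x j)"
  shows "ennreal (exp (\<Sum>j. w j * x j)) \<le> 1 + (\<Sum>j. ennreal (w j * exp (x j)))"
proof (cases "summable (\<lambda>j. w j * exp (x j))")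
  case True
  define m where "m = (\<Sum>j. w j * x j)"
  have tangent: "exp m * (1 + (y - m)) \<le> exp y" for y
    using mult_left_mono[OF exp_ge_add_one_self[of "y - m"], of "exp m"]
    by (simp add: exp_add[symmetric])
  have lin: "(\<lambda>j. exp m * ((1 - m) * w j + w j * x j)) sums (exp m * ((1 - m) * suminf w + m))"
    unfolding m_def by (intro sums_mult sums_add summable_sums w x)
  have "exp m * ((1 - m) * suminf w + m) \<le> (\<Sum>j. w j * exp (x j))"
  proof (rule sums_le[OF _ lin summable_sums[OF True]])
    fix j
    show "exp m * ((1 - m) * w j + w j * x j) \<le> w j * exp (x j)"
      using mult_left_mono[OF tangent[of "x j"] w(1)[of j]] by (simp add: algebra_simps)
  qed
  moreover have "(1 - suminf w) * (exp m * (1 - m)) \<le> 1 - suminf w"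
    using mult_left_mono[OF tangent[of 0], of "1 - suminf w"] w(3) by simp
  moreover have "0 \<le> suminf w"
    using w by (simp add: suminf_nonneg)
  ultimately have "exp m \<le> 1 + (\<Sum>j. w j * exp (x j))"
    by (simp add: algebra_simps)
  then have "ennreal (exp m) \<le> ennreal (1 + (\<Sum>j. w j * exp (x j)))"
    by (rule ennreal_leI)
  also have "\<dots> = 1 + (\<Sum>j. ennreal (w j * exp (x j)))"
    using True w(1) by (subst ennreal_plus) (auto simp: suminf_nonneg suminf_ennreal2)
  finally show ?thesis
    by (simp add: m_def)
next
  case False
  then have "(\<Sum>j. ennreal (w j * exp (x j))) = top"
    using w(1) by (intro summable_iff_suminf_neq_top) auto
  then show ?thesis
    by simp
qed

text \<open>
  In the extended nonnegative reals the series is measurable unconditionally, and summability is its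
  finiteness.
\<close>

lemma summable_weighted_sets:
  fixes l :: "nat \<Rightarrow> real"
  assumes l: "\<And>j. 0 \<le> l j" and N: "sets N = sets borel"
  shows "{z. summable (\<lambda>j. \<bar>z j\<bar> * l j)} \<in> sets (\<Pi>\<^sub>M j\<in>(UNIV::nat set). N)"
proof -
  let ?P = "\<Pi>\<^sub>M j\<in>(UNIV::nat set). N"
  have [measurable]: "(\<lambda>z. z j) \<in> ?P \<rightarrow>\<^sub>M borel" for j
    using measurable_component_singleton[of j UNIV "\<lambda>_. N"] by (simp cong: measurable_cong_sets add: N)
  have "space ?P = UNIV"
    using sets_eq_imp_space_eq[OF N] by (simp add: space_PiM)
  moreover have "summable (\<lambda>j. \<bar>z j\<bar> * l j) \<longleftrightarrow> (\<Sum>j. ennreal (\<bar>z j\<bar> * l j)) \<noteq> top" for z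
    using l ennreal_suminf_neq_top[of "\<lambda>j. \<bar>z j\<bar> * l j"] summable_suminf_not_top[of "\<lambda>j. \<bar>z j\<bar> * l j"]
    by (metis abs_ge_zero mult_nonneg_nonneg)
  ultimately have "{z. summable (\<lambda>j. \<bar>z j\<bar> * l j)}
    = {z \<in> space ?P. (\<Sum>j. ennreal (\<bar>z j\<bar> * l j)) \<noteq> top}"
    by simp
  also have "\<dots> \<in> sets ?P"
    by measurable
  finally show ?thesis .
qed

text \<open>
  Restricting to the summable sequences makes the real-valued series a limit rather than a default
  value, as the termwise comparison requires.
\<close>

lemma nn_integral_exp_series_finite:
  fixes l :: "nat \<Rightarrow> real" and N :: "real measure"
  assumes N: "prob_space N" "sets N = sets borel"
    and mgf: "\<And>t. (\<integral>\<^sup>+ x. ennreal (exp (t * \<bar>x\<bar>)) \<partial>N) < \<infinity>"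
    and l: "\<And>j. 0 \<le> l j" "summable l"
    and p: "0 \<le> p"
  defines "Q \<equiv> restrict_space (\<Pi>\<^sub>M j\<in>(UNIV::nat set). N) {z. summable (\<lambda>j. \<bar>z j\<bar> * l j)}"
  shows "(\<integral>\<^sup>+ z. ennreal (exp (p * (\<Sum>j. \<bar>z j\<bar> * l j))) \<partial>Q) < \<infinity>"
proof -
  let ?P = "\<Pi>\<^sub>M j\<in>(UNIV::nat set). N"
  let ?\<Omega> = "{z. summable (\<lambda>j. \<bar>z j\<bar> * l j)}"
  interpret N: prob_space N by (rule N)
  interpret P: prob_space ?P by (rule prob_space_PiM) (rule N)
  have comp[measurable]: "(\<lambda>z. z j) \<in> ?P \<rightarrow>\<^sub>M borel" for j
    using measurable_component_singleton[of j UNIV "\<lambda>_. N"] by (simp cong: measurable_cong_sets add: N)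
  \<comment> \<open>The summand \<open>1\<close> keeps \<open>\<Lambda>\<close> positive even if all \<open>l j\<close> vanish.\<close>
  define \<Lambda> where "\<Lambda> = 1 + suminf l"
  define w where "w = (\<lambda>j. l j / \<Lambda>)"
  have \<Lambda>: "1 \<le> \<Lambda>"
    using l by (simp add: \<Lambda>_def suminf_nonneg)
  have w: "\<And>j. 0 \<le> w j" "summable w" "suminf w \<le> 1"
    using l \<Lambda> by (simp_all add: w_def summable_divide suminf_divide, simp add: \<Lambda>_def)
  define M where "M = (\<integral>\<^sup>+ x. ennreal (exp (p * \<Lambda> * \<bar>x\<bar>)) \<partial>N)"
  have "(\<integral>\<^sup>+ z. ennreal (exp (p * (\<Sum>j. \<bar>z j\<bar> * l j))) \<partial>Q)
    = (\<integral>\<^sup>+ z. ennreal (exp (p * (\<Sum>j. \<bar>z j\<bar> * l j))) * indicator ?\<Omega> z \<partial>?P)"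
    unfolding Q_def
    using summable_weighted_sets[OF l(1) N(2)] by (intro nn_integral_restrict_space) (simp add: sets.Int_space_eq2)
  also have "\<dots> \<le> (\<integral>\<^sup>+ z. 1 + (\<Sum>j. ennreal (w j * exp (p * \<Lambda> * \<bar>z j\<bar>))) \<partial>?P)"
  proof (rule nn_integral_mono)
    fix z
    show "ennreal (exp (p * (\<Sum>j. \<bar>z j\<bar> * l j))) * indicator ?\<Omega> z
      \<le> 1 + (\<Sum>j. ennreal (w j * exp (p * \<Lambda> * \<bar>z j\<bar>)))"
    proof (cases "z \<in> ?\<Omega>")
      case True
      have eq: "w j * (p * \<Lambda> * \<bar>z j\<bar>) = p * (\<bar>z j\<bar> * l j)" for j
        using \<Lambda> by (simp add: w_def)
      have "summable (\<lambda>j. w j * (p * \<Lambda> * \<bar>z j\<bar>))"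
        unfolding eq using True by (intro summable_mult) simp
      from exp_weighted_series_le[OF w this] show ?thesis
        using True by (simp add: eq suminf_mult)
    qed simp
  qed
  also have "\<dots> = 1 + (\<Sum>j. ennreal (w j) * M)"
  proof -
    have "(\<integral>\<^sup>+ z. ennreal (w j * exp (p * \<Lambda> * \<bar>z j\<bar>)) \<partial>?P) = ennreal (w j) * M" for j
    proof -
      have "M = (\<integral>\<^sup>+ x. ennreal (exp (p * \<Lambda> * \<bar>x\<bar>)) \<partial>distr ?P N (\<lambda>z. z j))"
        unfolding M_def using distr_PiM_component[of UNIV "\<lambda>_. N" j] N by simp
      also have "\<dots> = (\<integral>\<^sup>+ z. ennreal (exp (p * \<Lambda> * \<bar>z j\<bar>)) \<partial>?P)"
        by (rule nn_integral_distr) (simp_all add: N measurable_component_singleton cong: measurable_cong_sets)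
      finally show ?thesis
        using w(1) by (simp add: ennreal_mult' nn_integral_cmult)
    qed
    then show ?thesis
      by (simp add: nn_integral_add nn_integral_suminf P.emeasure_space_1)
  qed
  also have "\<dots> < \<infinity>"
    using mgf[of "p * \<Lambda>"] ennreal_suminf_neq_top[OF w(2,1)]
    by (simp add: M_def ennreal_mult_less_top less_top del: suminf_ennreal)
  finally show ?thesis .
qed

section \<open>The failure probability\<close>

text \<open>Over a null space the essential supremum is \<open>-\<infinity>\<close>, which is converted to the real number \<open>0\<close>.\<close>

lemma Linf_norm_nonneg:
  assumes "f \<in> Linf_space M"
  shows "0 \<le> Linf_norm M f"
proof (rule ccontr)
  assume neg: "\<not> 0 \<le> Linf_norm M f"
  have "AE x in M. False"
    using AE_abs_le_Linf_norm[OF assms] by eventually_elim (use neg in linarith)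
  then have "emeasure M (space M) = 0"
    by (simp add: AE_iff_measurable[OF sets.top])
  moreover have "(\<lambda>x. ereal \<bar>f x\<bar>) \<in> borel_measurable M"
    using assms by (auto simp: Linf_space_def)
  ultimately have "Linf_norm M f = 0"
    unfolding Linf_norm_def by (subst esssup_zero_space) simp_all
  with neg show False
    by simp
qed

theorem mainTheorem8:
  fixes L :: "real^'d::finite" and \<rho> c\<^sub>\<beta> :: real and \<psi> :: "nat \<Rightarrow> real^'d \<Rightarrow> real"
  assumes L_pos: "\<And>n. 0 < L $ n"
    and rho: "0 < \<rho>" "\<rho> < 1"
    and c_beta: "0 < c\<^sub>\<beta>" "\<And>N::nat. 1 \<le> N \<Longrightarrow> c\<^sub>\<beta> * (real N)\<^sup>2 \<le> beta L \<rho> N"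
    and psi: "\<And>j. \<psi> j \<in> Linf_space (lebesgue_on (domain_box L))"
      "summable (\<lambda>j. Linf_norm (lebesgue_on (domain_box L)) (\<psi> j))"
  shows "\<forall>p::real. 1 \<le> p \<longrightarrow> (\<exists>C::real. 0 < C \<and> (\<forall>a::real \<times> (real^'d) \<Rightarrow> real. \<forall>N::nat.
    a \<in> Linf_space (lebesgue_on ({0<..} \<times> domain_box L)) \<longrightarrow> 1 \<le> N \<longrightarrow>
    3 * Linf_norm (lebesgue_on ({0<..} \<times> domain_box L)) a \<le> beta L \<rho> N \<longrightarrow>
    measure (sample_measure (domain_box L) \<psi>)
      {\<omega> \<in> space (sample_measure (domain_box L) \<psi>).
         diffusion_min (domain_box L) \<psi> \<omega> * beta L \<rho> N
           \<le> 3 * Linf_norm (lebesgue_on ({0<..} \<times> domain_box L)) a}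
      \<le> C * real N powr (- 2 * p) *
        (3 * inverse c\<^sub>\<beta> * Linf_norm (lebesgue_on ({0<..} \<times> domain_box L)) a) powr p))"
proof (intro allI impI)
  fix p :: real
  assume p: "1 \<le> p"
  let ?D = "domain_box L"
  let ?l = "\<lambda>j. Linf_norm (lebesgue_on ?D) (\<psi> j)"
  let ?S = "\<lambda>z. \<Sum>j. \<bar>z j\<bar> * ?l j"
  define Q where "Q = sample_measure ?D \<psi>"
  have Q: "Q = restrict_space (\<Pi>\<^sub>M j\<in>(UNIV::nat set). std_normal_distribution)
      {z. summable (\<lambda>j. \<bar>z j\<bar> * ?l j)}"
    by (simp add: Q_def sample_measure_def sample_space_def)
  have l: "0 \<le> ?l j" for j
    by (rule Linf_norm_nonneg[OF psi(1)])
  have "(\<integral>\<^sup>+ z. ennreal (exp (p * ?S z)) \<partial>Q) < \<infinity>"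
    unfolding Q
    by (rule nn_integral_exp_series_finite[OF _ _ std_normal_exp_abs_finite l psi(2)])
      (use p in \<open>auto intro: prob_space_normal_density\<close>)
  then obtain K where K: "0 \<le> K" "(\<integral>\<^sup>+ z. ennreal (exp (p * ?S z)) \<partial>Q) = ennreal K"
    by (cases "\<integral>\<^sup>+ z. ennreal (exp (p * ?S z)) \<partial>Q") auto
  have comp[measurable]: "(\<lambda>z. z j) \<in> Q \<rightarrow>\<^sub>M borel" for j
    unfolding Q by (intro measurable_restrict_space1) (simp add: measurable_component_singleton[of j UNIV "\<lambda>_. std_normal_distribution", simplified])
  have S[measurable]: "?S \<in> borel_measurable Q"
    by measurable
  show "\<exists>C>0. \<forall>(a::real \<times> (real^'d) \<Rightarrow> real) N::nat.
    a \<in> Linf_space (lebesgue_on ({0<..} \<times> ?D)) \<longrightarrow> 1 \<le> N \<longrightarrow>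
    3 * Linf_norm (lebesgue_on ({0<..} \<times> ?D)) a \<le> beta L \<rho> N \<longrightarrow>
    measure (sample_measure ?D \<psi>)
      {\<omega> \<in> space (sample_measure ?D \<psi>).
         diffusion_min ?D \<psi> \<omega> * beta L \<rho> N \<le> 3 * Linf_norm (lebesgue_on ({0<..} \<times> ?D)) a}
      \<le> C * real N powr (- 2 * p) *
        (3 * inverse c\<^sub>\<beta> * Linf_norm (lebesgue_on ({0<..} \<times> ?D)) a) powr p"
  proof (intro exI[of _ "K + 1"] conjI allI impI)
    show "0 < K + 1"
      using K by simp
    fix a :: "real \<times> (real^'d) \<Rightarrow> real" and N :: nat
    assume N: "1 \<le> N"
    define A where "A = 3 * Linf_norm (lebesgue_on ({0<..} \<times> ?D)) a"
    define b where "b = beta L \<rho> N"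
    define R where "R = (A / (c\<^sub>\<beta> * (real N)\<^sup>2)) powr p"
    have cN: "0 < c\<^sub>\<beta> * (real N)\<^sup>2"
      using c_beta(1) N by simp
    have b: "c\<^sub>\<beta> * (real N)\<^sup>2 \<le> b" "0 < b"
      using c_beta(2)[OF N] cN by (simp_all add: b_def)
    let ?F = "{z \<in> space Q. exp (- ?S z) * b \<le> A}"
    have "measure Q ?F \<le> K * R"
    proof (cases "0 < A")
      case False
      have "\<not> exp (- ?S z) * b \<le> A" for z :: "nat \<Rightarrow> real"
        using mult_pos_pos[OF exp_gt_zero[of "- ?S z"] b(2)] False by linarith
      then have "?F = {}"
        by blast
      then have "measure Q ?F = 0"
        by (simp only: measure_empty)
      then show ?thesis
        using K by (simp add: R_def)
    next
      case True
      define c where "c = (A / b) powr p"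
      have "?F \<subseteq> {z \<in> space Q. 1 \<le> ennreal c * ennreal (exp (p * ?S z))}"
      proof safe
        fix z
        assume "exp (- ?S z) * b \<le> A"
        then have "1 \<le> A / b * exp (?S z)"
          using b by (simp add: exp_minus field_simps)
        then have "1 \<le> (A / b * exp (?S z)) powr p"
          using p by (intro ge_one_powr_ge_zero) auto
        also have "\<dots> = c * exp (p * ?S z)"
          using True b unfolding c_def by (subst powr_mult) (simp add: exp_powr_real mult.commute)
        finally have "ennreal 1 \<le> ennreal (c * exp (p * ?S z))"
          by (rule ennreal_leI)
        then show "1 \<le> ennreal c * ennreal (exp (p * ?S z))"
          by (subst ennreal_mult[symmetric]) (simp_all only: c_def powr_ge_zero exp_ge_zero ennreal_1)
      qed
      moreover have "{z \<in> space Q. 1 \<le> ennreal c * ennreal (exp (p * ?S z))} \<in> sets Q"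
        by measurable
      ultimately have "emeasure Q ?F \<le> emeasure Q {z \<in> space Q. 1 \<le> ennreal c * ennreal (exp (p * ?S z))}"
        by (rule emeasure_mono)
      also have "\<dots> \<le> ennreal c * (\<integral>\<^sup>+ z. ennreal (exp (p * ?S z)) * indicator (space Q) z \<partial>Q)"
        by (rule nn_integral_Markov_inequality) simp_all
      also have "\<dots> = ennreal c * ennreal K"
        unfolding K(2)[symmetric] by (intro arg_cong2[where f = "(*)"] nn_integral_cong refl) simp
      finally have "emeasure Q ?F \<le> ennreal (c * K)"
        using K by (simp add: ennreal_mult'' c_def)
      then have "measure Q ?F \<le> c * K"
        unfolding measure_def using K by (intro enn2real_leI) (simp_all add: c_def)
      also have "\<dots> \<le> R * K"
        using K True b cN p
        by (intro mult_right_mono) (auto simp: c_def R_def intro!: powr_mono2 divide_left_mono)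
      finally show ?thesis
        by (simp only: mult.commute)
    qed
    also have "\<dots> \<le> (K + 1) * R"
      by (simp add: R_def mult_right_mono)
    also have "R = real N powr (- 2 * p) * (3 * inverse c\<^sub>\<beta> * Linf_norm (lebesgue_on ({0<..} \<times> ?D)) a) powr p"
    proof -
      have "A / (c\<^sub>\<beta> * (real N)\<^sup>2) = real N powr (- 2) * (3 * inverse c\<^sub>\<beta> * Linf_norm (lebesgue_on ({0<..} \<times> ?D)) a)"
        using N c_beta(1) by (simp add: A_def powr_minus powr_numeral field_simps)
      then show ?thesis
        by (simp add: R_def powr_mult powr_powr)
    qed
    finally show "measure (sample_measure ?D \<psi>)
      {\<omega> \<in> space (sample_measure ?D \<psi>).
         diffusion_min ?D \<psi> \<omega> * beta L \<rho> N \<le> 3 * Linf_norm (lebesgue_on ({0<..} \<times> ?D)) a}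
      \<le> (K + 1) * real N powr (- 2 * p) *
        (3 * inverse c\<^sub>\<beta> * Linf_norm (lebesgue_on ({0<..} \<times> ?D)) a) powr p"
      by (simp add: Q_def diffusion_min_def A_def b_def mult.assoc)
  qed
qed

end
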